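(* Let $p$ be a prime and $r\in\mathbb{N}$. Then, for all integers $n\ge 0$, $$y^{(n)}(p^r)=\begin{bmatrix} n+r-1\\ r\end{bmatrix}_{p}=\prod_{i=0}^{r-1}\frac{1-p^{\,n+r-1-i}}{1-p^{\,i+1}}.$$
   Context: $\mathbb{N}=\{1,2,3,\ldots\}$. The map $\mathrm{fix}$ sends an arithmetic function $f:\mathbb{N}\to\mathbb{C}$ to the arithmetic function given by $\mathrm{fix}(f)(n)=\sum_{d\mid n}d\,f(d)$ (sum over positive divisors). Let $\delta_1$ be the arithmetic function with $\delta_1(1)=1$ and $\delta_1(m)=0$ for $m>1$. Define $y^{(0)}=\delta_1$ and $y^{(n)}=\mathrm{fix}(y^{(n-1)})$ for $n\ge1$, so $y^{(n)}=\mathrm{fix}^n(\delta_1)$. The symbol $\begin{bmatrix} m\\ r\end{bmatrix}_q=\prod_{i=0}^{r-1}\frac{1-q^{m-i}}{1-q^{i+1}}$ denotes the Gaussian ($q$-)binomial coefficient (equal to $0$ for $0\le m<r$). *)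

theory Defs
  imports Complex_Main "HOL-Computational_Algebra.Primes"
begin

(* Arithmetic functions are functions nat => complex, of which only the values at positive
   arguments are meaningful.  For n > 0 every divisor of n is positive, so the value at 0 never
   enters; at n = 0 the divisor set is infinite and the sum is 0 by convention. *)

definition fix_map :: "(nat \<Rightarrow> complex) \<Rightarrow> nat \<Rightarrow> complex" where
  "fix_map f n = (\<Sum>d | d dvd n. of_nat d * f d)"

definition delta1 :: "nat \<Rightarrow> complex" where
  "delta1 m = (if m = 1 then 1 else 0)"

primrec y :: "nat \<Rightarrow> nat \<Rightarrow> complex" where
  "y 0 = delta1"
| "y (Suc n) = fix_map (y n)"

(* The upper argument is an integer, so that m - i is a true difference; the product formula
   is meaningful when q ^ (i + 1) is not 1 for i < r. *)

definition gauss_binomial :: "int \<Rightarrow> nat \<Rightarrow> 'a::field \<Rightarrow> 'a" where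
  "gauss_binomial m r q = (\<Prod>i<r. (1 - q powi (m - int i)) / (1 - q ^ (i + 1)))"

end

(* Along the powers of p the map fix becomes a weighted partial sum, so the values y^(n)(p^r)
   satisfy a two-term recurrence in n and r; it is the q-Pascal rule with q = p. *)

theory Submission
  imports Defs
begin

text \<open>The divisors of p^r are 1, p, ..., p^r, so passing from p^r to p^(r+1) adds one term to
  the sum (\<open>fix_map_prime_power\<close>): y^(n+1)(p^(r+1)) = y^(n+1)(p^r) + p^(r+1)
  y^(n)(p^(r+1)). The Gaussian binomials obey the same recurrence
  (\<open>gauss_binomial_pascal\<close>) and agree on the boundary: both sides are 1 for r = 0, and
  0 for n = 0 < r. A double induction then identifies them.\<close>

lemma gauss_binomial_0 [simp]: "gauss_binomial m 0 q = 1"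
  by (simp add: gauss_binomial_def)

lemma gauss_binomial_Suc:
  "gauss_binomial m (Suc r) q
     = gauss_binomial m r q * ((1 - q powi (m - int r)) / (1 - q ^ Suc r))"
  by (simp add: gauss_binomial_def)

text \<open>Here the first numerator factor is split off, in \<open>gauss_binomial_Suc\<close> the
  last one. Both leave \<open>gauss_binomial m r q\<close>, the common factor in the Pascal
  rule.\<close>

lemma gauss_binomial_Suc_Suc:
  "gauss_binomial (m + 1) (Suc r) q
     = gauss_binomial m r q * ((1 - q powi (m + 1)) / (1 - q ^ Suc r))"
proof -
  have "(\<Prod>i<Suc r. 1 - q powi (m + 1 - int i))
          = (1 - q powi (m + 1)) * (\<Prod>i<r. 1 - q powi (m - int i))"
    by (subst prod.lessThan_Suc_shift) simp
  then show ?thesis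
    by (simp add: gauss_binomial_def prod_dividef del: prod.lessThan_Suc)
      (simp add: field_simps)
qed

text \<open>With the common factor taken out, what remains is 1 - q^(m+1) = (1 - q^(r+1)) + q^(r+1)
  (1 - q^(m-r)).\<close>

lemma gauss_binomial_pascal:
  assumes "q \<noteq> 0" and "q ^ Suc r \<noteq> 1"
  shows "gauss_binomial (m + 1) (Suc r) q
    = gauss_binomial m r q + q ^ Suc r * gauss_binomial m (Suc r) q"
proof -
  \<comment> \<open>The exponent m - r may be negative, so adding exponents relies on q being
    nonzero.\<close>
  have pow: "q powi (m + 1) = q ^ Suc r * q powi (m - int r)"
    using power_int_add [of q "int (Suc r)" "m - int r"] assms(1)
    by (simp add: algebra_simps del: power_Suc of_nat_Suc) (simp add: algebra_simps)
  have "1 - q ^ Suc r \<noteq> 0"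
    using assms(2) by simp
  then have "(1 - q powi (m + 1)) / (1 - q ^ Suc r)
      = 1 + q ^ Suc r * ((1 - q powi (m - int r)) / (1 - q ^ Suc r))"
    unfolding pow by (simp add: divide_simps del: power_Suc) (simp add: algebra_simps)
  then show ?thesis
    unfolding gauss_binomial_Suc_Suc gauss_binomial_Suc [of m]
    by (simp only: distrib_left mult_1_right mult.left_commute)
qed

text \<open>The factor at index i has numerator 1 - q^0 = 0.\<close>

lemma gauss_binomial_eq_0:
  assumes "i < r"
  shows "gauss_binomial (int i) r q = 0"
  unfolding gauss_binomial_def using assms by (intro prod_zero) (auto intro!: bexI [of _ i])

lemma fix_map_prime_power:
  assumes "prime p"
  shows "fix_map f (p ^ r) = (\<Sum>k\<le>r. of_nat p ^ k * f (p ^ k))"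
proof -
  have "{d. d dvd p ^ r} = (\<lambda>k. p ^ k) ` {..r}"
    using assms by (auto simp: divides_primepow_nat)
  moreover have "inj_on (\<lambda>k. p ^ k) {..r}"
    using assms prime_gt_1_nat by (auto intro!: inj_onI)
  ultimately show ?thesis
    by (simp add: fix_map_def sum.reindex)
qed

text \<open>The outer induction on n keeps r arbitrary, since the recurrence uses y^(n) at p^(r+1).
  For n = r = 0 the upper argument is -1, but the product is empty.\<close>

lemma y_prime_power:
  assumes "prime p"
  shows "y n (p ^ r) = gauss_binomial (int n + int r - 1) r (of_nat p)"
proof (induction n arbitrary: r)
  case 0
  show ?case
  proof (cases r)
    case (Suc k)
    then have "p ^ r \<noteq> 1"
      using prime_gt_1_nat [OF assms] by (metis nat.distinct(1) nat_power_eq_Suc_0_iff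
        One_nat_def less_irrefl)
    \<comment> \<open>For n = 0 the upper argument is r - 1 = k, just below r.\<close>
    then show ?thesis
      using gauss_binomial_eq_0 [of k r] Suc by (simp add: delta1_def)
  qed (simp add: delta1_def)
next
  case (Suc n)
  note IH = Suc.IH
  show ?case
  proof (induction r)
    case 0
    show ?case
      using fix_map_prime_power [OF assms, of "y n" 0] IH [of 0] by simp
  next
    case (Suc r)
    have "p ^ Suc r \<noteq> 1"
      using prime_gt_1_nat [OF assms] by (metis nat.distinct(1) nat_power_eq_Suc_0_iff
        One_nat_def less_irrefl)
    then have "(of_nat p :: complex) ^ Suc r \<noteq> 1"
      by (metis of_nat_1 of_nat_eq_iff of_nat_power)
    moreover have "(of_nat p :: complex) \<noteq> 0"
      using prime_gt_0_nat [OF assms] by simp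
    ultimately have pascal: "gauss_binomial (int n + int r + 1) (Suc r) (of_nat p :: complex)
        = gauss_binomial (int n + int r) r (of_nat p)
          + of_nat p ^ Suc r * gauss_binomial (int n + int r) (Suc r) (of_nat p)"
      by (intro gauss_binomial_pascal)
    have "y (Suc n) (p ^ Suc r) = y (Suc n) (p ^ r) + of_nat p ^ Suc r * y n (p ^ Suc r)"
      by (simp add: fix_map_prime_power [OF assms] del: power_Suc)
    also have "\<dots> = gauss_binomial (int n + int r) r (of_nat p)
        + of_nat p ^ Suc r * gauss_binomial (int n + int r) (Suc r) (of_nat p)"
      \<comment> \<open>The inner hypothesis at (n+1, r) and the outer one at (n, r+1) share the
        upper argument n + r, as the Pascal rule requires.\<close>
      unfolding Suc.IH \<open>\<And>r. y n (p ^ r) = _ r\<close> by simp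
    also have "\<dots> = gauss_binomial (int (Suc n) + int (Suc r) - 1) (Suc r) (of_nat p)"
      using pascal by (simp add: algebra_simps)
    finally show ?case .
  qed
qed

theorem proposition3p1:
  fixes p r n :: nat
  assumes "prime p" and "r \<ge> 1"
  shows "y n (p ^ r) = gauss_binomial (int n + int r - 1) r (of_nat p)
       \<and> gauss_binomial (int n + int r - 1) r (of_nat p :: complex)
         = (\<Prod>i<r. (1 - of_nat p powi (int n + int r - 1 - int i)) / (1 - of_nat p ^ (i + 1)))"
  using y_prime_power [OF assms(1)] by (simp add: gauss_binomial_def)

end
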